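(* For every integer $p\ge 2$, $$\alpha(p) = \frac12\big(\zeta(p)-\xi(p)\big),\qquad \beta(p)=\frac12\big(\zeta(p)+\xi(p)\big).$$ In particular, for every integer $p\ge 1$, $$\alpha(2p) = \frac{1}{4^p}\,B_p\,\pi^{2p},\qquad \beta(2p)=\frac{4^p-1}{4^p}\,B_p\,\pi^{2p}.$$
   Context: For real $x>1$, $\zeta(x)=\sum_{n=1}^{+\infty}\frac{1}{n^x}$, $\alpha(x)=\sum_{m=1}^{+\infty}\frac{1}{(2m)^x}$ and $\beta(x)=\sum_{m=0}^{+\infty}\frac{1}{(2m+1)^x}$. For real $x>0$, $\xi(x)=\sum_{n=1}^{+\infty}\frac{(-1)^{n-1}}{n^x}$. The numbers $B_p$ ($p\ge 1$) are defined by $B_p=\zeta(2p)/\pi^{2p}$; they are rational and determined by $B_1=\frac16$ and, for $p\ge 2$, $B_p = \frac{(-1)^{p-1}}{(2p)!}\left(\frac{p}{2p+1} - \sum_{k=1}^{p-1}(-1)^{k-1}\frac{(2p)!}{(2p+1-2k)!}B_k\right)$. *)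

theory Defs
  imports "HOL-Analysis.Analysis"
begin

text \<open>
  The series are indexed from 0, so the \<open>n\<close>-th summand below is the one that is usually indexed
  by \<open>n + 1\<close> (except for \<open>beta\<close>, whose index starts at 0 anyway). The values are meaningful only
  where the series converge: for \<open>x > 1\<close> (\<open>zeta\<close>, \<open>alpha\<close>, \<open>beta\<close>) and for \<open>x > 0\<close> (\<open>xi\<close>).
\<close>

definition zeta :: "real \<Rightarrow> real" where
  "zeta x = (\<Sum>n. 1 / real (n + 1) powr x)"

definition alpha :: "real \<Rightarrow> real" where
  "alpha x = (\<Sum>m. 1 / real (2 * (m + 1)) powr x)"

definition beta :: "real \<Rightarrow> real" where
  "beta x = (\<Sum>m. 1 / real (2 * m + 1) powr x)"

definition xi :: "real \<Rightarrow> real" where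
  "xi x = (\<Sum>n. (- 1) ^ n / real (n + 1) powr x)"

text \<open>These are not the Bernoulli numbers, but the normalised zeta values; \<open>zeta_coeff 1 = 1 / 6\<close>.\<close>

definition zeta_coeff :: "nat \<Rightarrow> real" where
  "zeta_coeff p = zeta (real (2 * p)) / pi ^ (2 * p)"

end

theory Submission
  imports Defs
begin

text \<open>For \<open>x > 1\<close> the series of \<open>zeta\<close> and \<open>xi\<close> can be
  combined termwise. Half their difference keeps exactly the terms with even denominator base, half
  their sum those with odd base; this gives \<open>alpha_eq_zeta_xi\<close> and
  \<open>beta_eq_zeta_xi\<close>. Pulling \<open>2 powr x\<close> out of the even terms gives
  \<open>alpha_eq_zeta\<close>. At \<open>x = 2 * p\<close> this factor is \<open>4 ^ p\<close>, and
  \<open>beta\<close> is what remains of \<open>zeta\<close> once \<open>alpha\<close> is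
  removed.\<close>

lemma summable_zeta:
  fixes x :: real
  assumes "x > 1"
  shows "summable (\<lambda>n. 1 / real (n + 1) powr x)"
proof -
  have "summable (\<lambda>n. real (Suc n) powr - x)"
    by (subst summable_Suc_iff) (use assms in \<open>simp add: summable_real_powr_iff\<close>)
  then show ?thesis
    by (simp add: powr_minus_divide)
qed

text \<open>Absolute convergence: the signs disappear in the norm, leaving the terms of
  \<open>zeta\<close>.\<close>

lemma summable_xi:
  fixes x :: real
  assumes "x > 1"
  shows "summable (\<lambda>n. (- 1) ^ n / real (n + 1) powr x)"
  by (rule summable_comparison_test'[OF summable_zeta[OF assms], where N = 0])
    (simp add: power_abs)

lemma alpha_eq_zeta_xi:
  assumes "x > 1"
  shows "alpha x = 1 / 2 * (zeta x - xi x)"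
proof -
  let ?f = "\<lambda>n. 1 / 2 * (1 / real (n + 1) powr x - (- 1) ^ n / real (n + 1) powr x)"
  have "?f sums (1 / 2 * (zeta x - xi x))"
    unfolding zeta_def xi_def
    by (intro sums_mult sums_diff summable_sums summable_zeta summable_xi assms)
  \<comment> \<open>Indices start at 0, so the even bases \<open>n + 1\<close> sit at odd
    \<open>n\<close>; at even \<open>n\<close> the two terms cancel.\<close>
  moreover have "?f n = 0" if "n \<notin> range (\<lambda>m. 2 * m + 1)" for n
    using that by (cases "even n") (auto elim: oddE)
  \<comment> \<open>Vanishing terms may be skipped along a strictly increasing reindexing without
    changing the sum.\<close>
  ultimately have "(\<lambda>m. ?f (2 * m + 1)) sums (1 / 2 * (zeta x - xi x))"
    by (subst sums_mono_reindex) (auto simp: strict_mono_def)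
  then show ?thesis
    unfolding alpha_def by (simp add: sums_iff add.commute)
qed

lemma beta_eq_zeta_xi:
  assumes "x > 1"
  shows "beta x = 1 / 2 * (zeta x + xi x)"
proof -
  let ?f = "\<lambda>n. 1 / 2 * (1 / real (n + 1) powr x + (- 1) ^ n / real (n + 1) powr x)"
  have "?f sums (1 / 2 * (zeta x + xi x))"
    unfolding zeta_def xi_def
    by (intro sums_mult sums_add summable_sums summable_zeta summable_xi assms)
  \<comment> \<open>With the plus sign the cancellation happens at odd \<open>n\<close>, so the odd
    bases \<open>2 * m + 1\<close> survive.\<close>
  moreover have "?f n = 0" if "n \<notin> range (\<lambda>m. 2 * m)" for n
    using that by (cases "even n") (auto elim: evenE)
  ultimately have "(\<lambda>m. ?f (2 * m)) sums (1 / 2 * (zeta x + xi x))"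
    by (subst sums_mono_reindex) (auto simp: strict_mono_def)
  then show ?thesis
    unfolding beta_def by (simp add: sums_iff)
qed

text \<open>Each term of \<open>alpha\<close> is the corresponding term of \<open>zeta\<close>
  divided by the constant \<open>2 powr x\<close>, by multiplicativity of \<open>powr\<close> in its
  base.\<close>

lemma alpha_eq_zeta:
  assumes "x > 1"
  shows "alpha x = zeta x / 2 powr x"
proof -
  have "1 / real (2 * (m + 1)) powr x = 1 / real (m + 1) powr x / 2 powr x" for m
    using powr_mult[of 2 "real (m + 1)" x] by (simp add: mult.commute)
  then show ?thesis
    unfolding alpha_def zeta_def
    using suminf_divide[OF summable_zeta[OF assms], of "2 powr x"] by simp
qed

theorem proposition5:
  shows "(\<forall>p::nat. p \<ge> 2 \<longrightarrow>
            alpha (real p) = 1 / 2 * (zeta (real p) - xi (real p)) \<and>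
            beta (real p) = 1 / 2 * (zeta (real p) + xi (real p))) \<and>
         (\<forall>p::nat. p \<ge> 1 \<longrightarrow>
            alpha (real (2 * p)) = 1 / 4 ^ p * zeta_coeff p * pi ^ (2 * p) \<and>
            beta (real (2 * p)) = (4 ^ p - 1) / 4 ^ p * zeta_coeff p * pi ^ (2 * p))"
proof (intro conjI allI impI)
  fix p :: nat
  assume "p \<ge> 2"
  then show "alpha (real p) = 1 / 2 * (zeta (real p) - xi (real p))"
    and "beta (real p) = 1 / 2 * (zeta (real p) + xi (real p))"
    by (simp_all add: alpha_eq_zeta_xi beta_eq_zeta_xi)
next
  fix p :: nat
  assume "p \<ge> 1"
  then have gt: "real (2 * p) > 1"
    by simp
  have pow: "2 powr real (2 * p) = (4 :: real) ^ p"
    by (subst powr_realpow) (simp_all add: power_mult)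
  have zeta: "zeta (real (2 * p)) = zeta_coeff p * pi ^ (2 * p)"
    by (simp add: zeta_coeff_def)
  have alpha: "alpha (real (2 * p)) = zeta (real (2 * p)) / 4 ^ p"
    using alpha_eq_zeta[OF gt] unfolding pow .
  show "alpha (real (2 * p)) = 1 / 4 ^ p * zeta_coeff p * pi ^ (2 * p)"
    unfolding alpha zeta by simp
  \<comment> \<open>Adding the two half-sum formulas eliminates \<open>xi\<close>.\<close>
  have "beta (real (2 * p)) = zeta (real (2 * p)) - alpha (real (2 * p))"
    unfolding alpha_eq_zeta_xi[OF gt] beta_eq_zeta_xi[OF gt] by (simp add: field_simps)
  then show "beta (real (2 * p)) = (4 ^ p - 1) / 4 ^ p * zeta_coeff p * pi ^ (2 * p)"
    unfolding alpha zeta by (simp add: field_simps)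
qed

end
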